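(* Let $n$ be a positive integer, $p\in[0,1]$, and let $B\sim\mathrm{Bin}(n,p)$. Then for any real $t\in(np,n)$ we have $$\inf_{f}\frac{1}{f(t)}\mathbb{E}[f(B)]=\inf_{a<t}\frac{1}{t-a}\mathbb{E}\left[\max\{0,B-a\}\right],$$ where the infimum on the left hand side is taken over all functions $f\in\mathcal{F}_{ic}(t)$ and the infimum on the right is over real numbers $a<t$.
   Context: $\mathrm{Bin}(n,p)$ is the binomial distribution with parameters $n$ and $p$. For fixed $t>0$, $\mathcal{F}_{ic}(t)$ is the set of all convex functions $f:[0,\infty)\to[0,\infty)$ that are increasing (in the sense of nondecreasing) on $[t,\infty)$; the infimum is over those $f$ with $f(t)>0$. *)

theory Defs
  imports "HOL-Probability.Probability"
begin

text \<open>Functions on \<open>[0, \<infinity>)\<close> are represented by total functions on the reals; their values at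
  negative arguments are unconstrained and play no role.\<close>

definition F_ic :: "real \<Rightarrow> (real \<Rightarrow> real) set" where
  "F_ic t = {f. f \<in> {0..} \<rightarrow> {0..} \<and> convex_on {0..} f \<and> mono_on {t..} f}"

end

theory Submission imports Defs begin

text \<open>
  The hinge functions \<open>x \<mapsto> max 0 (x - a)\<close> with \<open>a < t\<close> belong to the class on the left, so the
  infimum on the left is at most the one on the right.

  For the converse, take \<open>f\<close> in the class and a supporting line of \<open>f\<close> at \<open>t\<close>; its slope \<open>s\<close> can be
  chosen nonnegative because \<open>f\<close> increases to the right of \<open>t\<close>.  If \<open>s > 0\<close>, this line vanishes at
  \<open>a = t - f t / s < t\<close>, and since \<open>f\<close> also is nonnegative, it lies above the hinge
  \<open>s * max 0 (x - a)\<close>, with equality at \<open>t\<close>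
  (\<open>hinge_below_or_flat_line_below\<close>).  Dividing by \<open>f t = s * (t - a)\<close> shows that the hinge does at
  least as well as \<open>f\<close>.  If \<open>s = 0\<close>, then \<open>f \<ge> f t\<close> on the half-line, so \<open>f\<close> only yields a bound of
  at least \<open>1\<close>; the hinge at \<open>a = 0\<close> yields \<open>\<mu> / t < 1\<close>, where \<open>\<mu>\<close> is the mean.

  The comparison is between pointwise inequalities on the half-line, so it is carried out in
  \<open>INF_convex_eq_INF_hinge\<close> for an arbitrary finitely supported nonnegative law with mean below
  \<open>t\<close>; finite support makes every function integrable.  The law of \<open>B\<close> is of this kind, its mean being
  \<open>n * p\<close>.
\<close>

lemma hinge_in_F_ic:
  "(\<lambda>x. max 0 (x - a)) \<in> F_ic t"
proof -
  have "convex_on {0..} (\<lambda>x::real. max 0 (x - a))"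
  proof (rule convex_onI)
    fix u x y :: real
    assume u: "u > 0" "u < 1"
    have "(1 - u) * (x - a) \<le> (1 - u) * max 0 (x - a)" "u * (y - a) \<le> u * max 0 (y - a)"
      "0 \<le> (1 - u) * max 0 (x - a)" "0 \<le> u * max 0 (y - a)"
      using u by (auto intro!: mult_left_mono)
    moreover have "(1 - u) *\<^sub>R x + u *\<^sub>R y - a = (1 - u) * (x - a) + u * (y - a)"
      by (simp add: algebra_simps)
    ultimately show "max 0 ((1 - u) *\<^sub>R x + u *\<^sub>R y - a)
        \<le> (1 - u) * max 0 (x - a) + u * max 0 (y - a)"
      by linarith
  qed simp
  then show ?thesis
    by (auto simp: F_ic_def mono_on_def)
qed

text \<open>The slope is the right derivative, an infimum of the difference quotients over points beyond
  \<open>t\<close>, which are nonnegative by monotonicity.\<close>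

lemma F_ic_supporting_line:
  assumes f: "f \<in> F_ic t" and t: "t > 0"
  obtains s where "s \<ge> 0" "\<And>x. x \<ge> 0 \<Longrightarrow> f x \<ge> f t + s * (x - t)"
proof
  define s where "s = Inf ((\<lambda>x. (f t - f x) / (t - x)) ` ({t<..} \<inter> {0..}))"
  have "t + 1 \<in> {t<..} \<inter> {0..}"
    using t by simp
  then have "{t<..} \<inter> {0..} \<noteq> {}"
    by blast
  then show "s \<ge> 0"
    unfolding s_def
  proof (intro cInf_greatest)
    fix y assume "y \<in> (\<lambda>x. (f t - f x) / (t - x)) ` ({t<..} \<inter> {0..})"
    then obtain x where x: "y = (f t - f x) / (t - x)" "x > t" by auto
    have "f t \<le> f x"
      using f x(2) by (auto simp: F_ic_def mono_on_def)
    then show "0 \<le> y"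
      using x by (simp add: divide_nonpos_nonpos)
  qed auto
  show "f x \<ge> f t + s * (x - t)" if "x \<ge> 0" for x
    unfolding s_def using f t that
    by (intro convex_le_Inf_differential) (auto simp: F_ic_def)
qed

text \<open>Normalised by its value at \<open>t\<close>, a function of the class dominates a normalised hinge unless
  its supporting line at \<open>t\<close> is horizontal and so never reaches zero; the second alternative is this
  degenerate case.\<close>

lemma hinge_below_or_flat_line_below:
  assumes f: "f \<in> F_ic t" and t: "t > 0" and ft: "f t > 0"
  obtains (hinge) a where "a < t" "\<And>x. x \<ge> 0 \<Longrightarrow> max 0 (x - a) / (t - a) \<le> f x / f t"
  | (flat) "\<And>x. x \<ge> 0 \<Longrightarrow> 1 \<le> f x / f t"
proof -
  obtain s where s: "s \<ge> 0" and line: "\<And>x. x \<ge> 0 \<Longrightarrow> f x \<ge> f t + s * (x - t)"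
    using F_ic_supporting_line[OF f t] by blast
  show thesis
  proof (cases "s = 0")
    case True
    then show thesis
      using line ft by (intro flat) simp
  next
    case False
    with s have s: "s > 0" by simp
    define a where "a = t - f t / s"
    have ft_eq: "f t = s * (t - a)"
      using s by (simp add: a_def)
    have "max 0 (x - a) / (t - a) \<le> f x / f t" if x: "x \<ge> 0" for x
    proof -
      have "s * (x - a) \<le> f x"
        using line[OF x] ft_eq by (simp add: algebra_simps)
      moreover have "0 \<le> f x"
        using f x by (auto simp: F_ic_def)
      ultimately have "s * max 0 (x - a) \<le> f x"
        by (simp add: max_def)
      then have "s * max 0 (x - a) / f t \<le> f x / f t"
        using ft by (simp add: divide_right_mono)
      then show ?thesis
        using s by (simp add: ft_eq)
    qed
    moreover have "a < t"
      using s ft by (simp add: a_def)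
    ultimately show thesis
      by (intro hinge)
  qed
qed

lemma INF_convex_eq_INF_hinge:
  fixes q :: "real pmf"
  assumes fin: "finite (set_pmf q)" and nonneg: "set_pmf q \<subseteq> {0..}"
    and t: "t > 0" and mean: "measure_pmf.expectation q (\<lambda>x. x) < t"
  shows "(INF f \<in> {f \<in> F_ic t. f t > 0}. 1 / f t * measure_pmf.expectation q f)
       = (INF a \<in> {..<t}. 1 / (t - a) * measure_pmf.expectation q (\<lambda>x. max 0 (x - a)))"
    (is "(INF f \<in> ?F. ?L f) = (INF a \<in> ?A. ?R a)")
proof (rule antisym)
  have int: "integrable q g" for g :: "real \<Rightarrow> real"
    using fin by (rule integrable_measure_pmf_finite)
  have mono: "measure_pmf.expectation q g \<le> measure_pmf.expectation q h"
    if "\<And>x. x \<ge> 0 \<Longrightarrow> g x \<le> h x" for g h :: "real \<Rightarrow> real"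
    using that nonneg by (intro integral_mono_AE int) (auto simp: AE_measure_pmf_iff)
  have L_nonneg: "0 \<le> ?L f" if "f \<in> ?F" for f
  proof -
    have "0 \<le> measure_pmf.expectation q f"
      using mono[of "\<lambda>_. 0" f] that by (auto simp: F_ic_def)
    then show ?thesis
      using that by simp
  qed
  have R_nonneg: "0 \<le> ?R a" if "a \<in> ?A" for a
    using mono[of "\<lambda>_. 0" "\<lambda>x. max 0 (x - a)"] that by auto
  have hinge_mem: "(\<lambda>x. max 0 (x - a)) \<in> ?F" if "a < t" for a
    using hinge_in_F_ic[of a t] that by simp
  show "(INF f \<in> ?F. ?L f) \<le> (INF a \<in> ?A. ?R a)"
  proof (rule cINF_mono)
    show "?A \<noteq> {}" by (auto intro: lt_ex)
    show "bdd_below (?L ` ?F)" using L_nonneg by (rule bdd_belowI2)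
    show "\<exists>f\<in>?F. ?L f \<le> ?R a" if "a \<in> ?A" for a
      using that hinge_mem[of a] by (intro bexI[of _ "\<lambda>x. max 0 (x - a)"]) auto
  qed
  show "(INF a \<in> ?A. ?R a) \<le> (INF f \<in> ?F. ?L f)"
  proof (rule cINF_mono)
    show "?F \<noteq> {}" using hinge_mem[OF t] by blast
    show "bdd_below (?R ` ?A)" using R_nonneg by (rule bdd_belowI2)
    fix f assume f: "f \<in> ?F"
    then have "f \<in> F_ic t" "f t > 0" by auto
    from this(1) t this(2) show "\<exists>a\<in>?A. ?R a \<le> ?L f"
    proof (cases rule: hinge_below_or_flat_line_below)
      case (hinge a)
      from mono[OF hinge(2)] have "?R a \<le> ?L f"
        by (simp add: field_simps)
      with hinge(1) show ?thesis by auto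
    next
      case flat
      \<comment> \<open>On the half-line the hinge at \<open>0\<close> is the identity, so its value is the mean over \<open>t\<close>.\<close>
      have "measure_pmf.expectation q (\<lambda>x. max 0 (x - 0)) \<le> measure_pmf.expectation q (\<lambda>x. x)"
        by (rule mono) simp
      then have "?R 0 \<le> 1"
        using mean t by (simp add: field_simps)
      also have "1 \<le> ?L f"
        using mono[OF flat] by (simp add: field_simps)
      finally show ?thesis
        using t by (intro bexI[of _ 0]) auto
    qed
  qed
qed

text \<open>The expectation is the first moment of the Bernstein polynomials at \<open>p\<close>.\<close>

lemma expectation_binomial_pmf_real:
  assumes "p \<in> {0..1}"
  shows "measure_pmf.expectation (binomial_pmf n p) real = real n * p"
proof -
  have "measure_pmf.expectation (binomial_pmf n p) real = (\<Sum>k\<le>n. real k * Bernstein n k p)"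
    unfolding expectation_binomial_pmf'[OF assms] Bernstein_def
    by (intro sum.cong) (auto simp: algebra_simps)
  then show ?thesis
    by simp
qed

theorem corollary3p5:
  fixes n :: nat and p t :: real and M :: "'a measure" and B :: "'a \<Rightarrow> nat"
  assumes "n > 0" and "p \<in> {0..1}"
    and "prob_space M"
    and "B \<in> measurable M (count_space UNIV)"
    and "distr M (count_space UNIV) B = measure_pmf (binomial_pmf n p)"
    and "t \<in> {real n * p<..<real n}"
  shows "(INF f \<in> {f \<in> F_ic t. f t > 0}. 1 / f t * prob_space.expectation M (\<lambda>\<omega>. f (real (B \<omega>))))
       = (INF a \<in> {..<t}. 1 / (t - a) * prob_space.expectation M (\<lambda>\<omega>. max 0 (real (B \<omega>) - a)))"
proof -
  define q where "q = map_pmf real (binomial_pmf n p)"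
  have transfer: "prob_space.expectation M (\<lambda>\<omega>. g (real (B \<omega>))) = measure_pmf.expectation q g"
    for g :: "real \<Rightarrow> real"
  proof -
    have "prob_space.expectation M (\<lambda>\<omega>. g (real (B \<omega>)))
        = integral\<^sup>L (distr M (count_space UNIV) B) (\<lambda>k. g (real k))"
      using assms(4) by (intro integral_distr[symmetric]) auto
    also have "\<dots> = measure_pmf.expectation q g"
      by (simp add: assms(5) q_def)
    finally show ?thesis .
  qed
  have "finite (set_pmf q)" "set_pmf q \<subseteq> {0..}"
    using finite_set_pmf_binomial_pmf[OF assms(2)] by (auto simp: q_def)
  moreover have "t > 0"
  proof -
    have "0 \<le> real n * p" using assms(2) by simp
    then show ?thesis using assms(6) by simp
  qed
  moreover have "measure_pmf.expectation q (\<lambda>x. x) < t"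
    using assms(6) expectation_binomial_pmf_real[OF assms(2)] by (simp add: q_def)
  ultimately show ?thesis
    using INF_convex_eq_INF_hinge[of q t] transfer transfer[of "\<lambda>x. max 0 (x - a)" for a] by simp
qed

end
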